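(* The following properties hold. 1. Let $\bm{A}=(A_1,\dots,A_{p_1})^\top$ and $\bm{B}=(B_1,\dots,B_{p_2})^\top$ be random vectors on a common probability space with entries in $\{-1,1\}$. Then $\bm{A}$ and $\bm{B}$ are independent if and only if $\bm{A}^{\otimes}$ and $\bm{B}^{\otimes}$ are uncorrelated for all coordinate pairs, i.e. $\mathrm{Cov}(\bm{A}^{\otimes}_i,\bm{B}^{\otimes}_j)=0$ for all $1\le i\le 2^{p_1}$ and $1\le j\le 2^{p_2}$. 2. Let $B$ be a random variable with values in $\{-1,1\}$ and $\bm{A}$ a random vector with values in $\{-1,1\}^p$, jointly distributed. Then there is a constant vector $\bm{\beta}\in\mathbb{R}^{2^p}$ such that $\mathbf{E}[B\mid \bm{A}]=\bm{\beta}^\top \bm{A}^{\otimes}$ (almost surely). 3. In the setting of item 2 (that is, $B\in\{-1,1\}$, $\bm{A}\in\{-1,1\}^p$ and $\mathbf{E}[B\mid\bm{A}]=\bm{\beta}^\top\bm{A}^{\otimes}$), if the matrix $\mathbf{E}[\bm{A}^{\otimes}\bm{A}^{\otimes\top}]$ is invertible, then $\bm{\beta}=\left(\mathbf{E}[\bm{A}^{\otimes}\bm{A}^{\otimes\top}]\right)^{-1}\mathbf{E}[\bm{A}^{\otimes}B]$, and $\bm{\beta}$ satisfies (a) $|\bm{\beta}^\top\bm{A}^{\otimes}|\le 1$, (b) $\|\mathbf{H}_{2^p}\bm{\beta}\|_\infty\le 1$, and (c) $\|\bm{\beta}\|_2\le 1$.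
   Context: For a vector $\bm{A}=(A_1,\dots,A_p)^\top\in\{-1,1\}^p$, define $\bm{A}^{\otimes}=\begin{pmatrix}1\\ A_1\end{pmatrix}\otimes\begin{pmatrix}1\\ A_2\end{pmatrix}\otimes\cdots\otimes\begin{pmatrix}1\\ A_p\end{pmatrix}\in\{-1,1\}^{2^p}$ (Kronecker product); its coordinates are all products $\prod_{j\in\Lambda}A_j$, $\Lambda\subseteq\{1,\dots,p\}$ (the empty product being $1$). $\mathbf{H}_{2^p}$ is the Hadamard matrix of Sylvester's construction: $\mathbf{H}_1=(1)$, $\mathbf{H}_{2m}=\begin{pmatrix}\mathbf{H}_m&\mathbf{H}_m\\ \mathbf{H}_m&-\mathbf{H}_m\end{pmatrix}$; its rows are exactly the $2^p$ possible values of $\bm{A}^{\otimes}$. *)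

theory Defs
  imports
    "HOL-Probability.Probability"
    "Jordan_Normal_Form.Gauss_Jordan_Elimination"
begin

text \<open>Vectors and matrices are those of \<^theory>\<open>Jordan_Normal_Form.Matrix\<close> (0-based, with the
  dimension a natural number); the homonymous finite Cartesian products are hidden.\<close>

hide_type (open) Finite_Cartesian_Product.vec
hide_const (open) Finite_Cartesian_Product.vec
unbundle no vec_syntax
unbundle no inner_syntax

definition sign_vecs :: "nat \<Rightarrow> real vec set" where
  "sign_vecs p = {v \<in> carrier_vec p. \<forall>i<p. v $ i \<in> {-1, 1}}"

text \<open>A finite set such as \<^term>\<open>sign_vecs p\<close> carries the discrete sigma-algebra.
  A random vector with entries in $\{-1,1\}$ is an element of
  \<^term>\<open>M \<rightarrow>\<^sub>M count_space (sign_vecs p)\<close>, which is the same as measurability of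
  every coordinate.\<close>

definition kron_vec :: "real vec \<Rightarrow> real vec \<Rightarrow> real vec" where
  "kron_vec u v =
     Matrix.vec (dim_vec u * dim_vec v) (\<lambda>i. u $ (i div dim_vec v) * v $ (i mod dim_vec v))"

text \<open>The final factor $(1)$ is the neutral element of the Kronecker product.\<close>

definition otimes_vec :: "real vec \<Rightarrow> real vec" where
  "otimes_vec a = foldr kron_vec (map (\<lambda>x. vec_of_list [1, x]) (list_of_vec a)) (vec_of_list [1])"

text \<open>\<^term>\<open>sylvester p\<close> is the Hadamard matrix of order $2^p$.\<close>

fun sylvester :: "nat \<Rightarrow> real mat" where
  "sylvester 0 = 1\<^sub>m 1"
| "sylvester (Suc p) =
     four_block_mat (sylvester p) (sylvester p) (sylvester p) (- sylvester p)"

definition covariance :: "'a measure \<Rightarrow> ('a \<Rightarrow> real) \<Rightarrow> ('a \<Rightarrow> real) \<Rightarrow> real" where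
  "covariance M X Y =
     (\<integral>w. (X w - (\<integral>w'. X w' \<partial>M)) * (Y w - (\<integral>w'. Y w' \<partial>M)) \<partial>M)"

definition outer_prod :: "real vec \<Rightarrow> real vec \<Rightarrow> real mat" where
  "outer_prod u v = transpose_mat (mat_of_row u) * mat_of_row v"

definition expect_vec :: "'a measure \<Rightarrow> nat \<Rightarrow> ('a \<Rightarrow> real vec) \<Rightarrow> real vec" where
  "expect_vec M n X = Matrix.vec n (\<lambda>i. \<integral>w. X w $ i \<partial>M)"

definition expect_mat :: "'a measure \<Rightarrow> nat \<Rightarrow> nat \<Rightarrow> ('a \<Rightarrow> real mat) \<Rightarrow> real mat" where
  "expect_mat M n m X = Matrix.mat n m (\<lambda>(i, j). \<integral>w. X w $$ (i, j) \<partial>M)"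

definition gen_algebra :: "'a measure \<Rightarrow> nat \<Rightarrow> ('a \<Rightarrow> real vec) \<Rightarrow> 'a measure" where
  "gen_algebra M p A = vimage_algebra (space M) A (count_space (sign_vecs p))"

definition l2_norm_vec :: "real vec \<Rightarrow> real" where
  "l2_norm_vec v = L2_set (\<lambda>i. v $ i) {..<dim_vec v}"

text \<open>Only meaningful for vectors of positive dimension.\<close>

definition linf_norm_vec :: "real vec \<Rightarrow> real" where
  "linf_norm_vec v = Max ((\<lambda>i. \<bar>v $ i\<bar>) ` {..<dim_vec v})"

end

theory Submission
  imports Defs
begin

text \<open>Every real function on $\{-1,1\}^p$ has the form $a \mapsto \beta^\top a^\otimes$ for a vector $\beta$.
  Applied to indicators, this turns vanishing covariances into the product formula for probabilities;
  applied to a factorisation of $E[B \mid A]$ through $A$, it gives the regression formula.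
  If the Gram matrix $E[A^\otimes A^{\otimes\top}]$ is invertible then every sign vector is attained with
  positive probability, so $|E[B \mid A]| \le 1$ forces $|\beta^\top a^\otimes| \le 1$ for all sign vectors $a$.
  These numbers are the entries of $H\beta$, and $\|H\beta\|_2^2 = 2^p \|\beta\|_2^2$.\<close>

section \<open>Recursion for Kronecker powers and sign vectors\<close>

lemma otimes_vec_vNil [simp]: "otimes_vec vNil = vCons 1 vNil"
  by (simp add: otimes_vec_def)

text \<open>The quotient \<open>i div dim_vec v\<close> is 0 on the first half of the indices and 1
  on the second, so it selects the factor 1 or \<open>x\<close>. Replacing the index arithmetic of
  \<open>kron_vec\<close> by concatenation makes induction on the number of coordinates
  possible.\<close>

lemma kron_vec_sign: "kron_vec (vCons 1 (vCons x vNil)) v = v @\<^sub>v x \<cdot>\<^sub>v v"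
proof (rule eq_vecI)
  fix i assume "i < dim_vec (v @\<^sub>v x \<cdot>\<^sub>v v)"
  then have i: "i < 2 * dim_vec v"
    by simp
  show "kron_vec (vCons 1 (vCons x vNil)) v $ i = (v @\<^sub>v x \<cdot>\<^sub>v v) $ i"
  proof (cases "i < dim_vec v")
    case True
    then show ?thesis
      using i by (simp add: kron_vec_def)
  next
    case False
    then have "i div dim_vec v = 1" "i mod dim_vec v = i - dim_vec v"
      using i by (simp_all add: div_nat_eqI le_mod_geq)
    then show ?thesis
      using i False by (simp add: kron_vec_def vec_index_vCons)
  qed
qed (simp add: kron_vec_def)

lemma otimes_vec_vCons [simp]: "otimes_vec (vCons x a) = otimes_vec a @\<^sub>v x \<cdot>\<^sub>v otimes_vec a"
  by (simp add: otimes_vec_def kron_vec_sign)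

lemma dim_otimes_vec [simp]: "dim_vec (otimes_vec a) = 2 ^ dim_vec a"
  by (induction a) auto

lemma otimes_vec_carrier: "a \<in> carrier_vec p \<Longrightarrow> otimes_vec a \<in> carrier_vec (2 ^ p)"
  by (auto intro!: carrier_vecI)

lemma sign_vecs_0: "sign_vecs 0 = {vNil}"
  by (auto simp: sign_vecs_def)

lemma vCons_sign_vecs_iff [simp]:
  "vCons x a \<in> sign_vecs (Suc p) \<longleftrightarrow> x \<in> {-1, 1} \<and> a \<in> sign_vecs p"
  unfolding sign_vecs_def by (simp add: All_less_Suc2) blast

lemma sign_vecs_Suc: "sign_vecs (Suc p) = (\<lambda>(x, a). vCons x a) ` ({-1, 1} \<times> sign_vecs p)"
proof (intro equalityI subsetI)
  fix v assume v: "v \<in> sign_vecs (Suc p)"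
  then obtain x a where "v = vCons x a"
    by (cases v) (auto simp: sign_vecs_def)
  with v show "v \<in> (\<lambda>(x, a). vCons x a) ` ({-1, 1} \<times> sign_vecs p)"
    by force
qed auto

lemma finite_sign_vecs [simp]: "finite (sign_vecs p)"
  by (induction p) (auto simp: sign_vecs_0 sign_vecs_Suc)

lemma sign_vecs_carrier: "a \<in> sign_vecs p \<Longrightarrow> a \<in> carrier_vec p"
  by (simp add: sign_vecs_def)

lemma sign_vecs_otimes_carrier: "a \<in> sign_vecs p \<Longrightarrow> otimes_vec a \<in> carrier_vec (2 ^ p)"
  by (simp add: otimes_vec_carrier sign_vecs_carrier)

section \<open>Functions on sign vectors as linear forms in the Kronecker power\<close>

text \<open>The two halves of a coefficient vector belong to the monomials without and with the
  first coordinate. This is the inductive step for expanding functions of signs.\<close>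

lemma scalar_prod_append_otimes:
  assumes "u \<in> carrier_vec (2 ^ p)" "v \<in> carrier_vec (2 ^ p)" "a \<in> carrier_vec p"
  shows "(u @\<^sub>v v) \<bullet> otimes_vec (vCons x a) = u \<bullet> otimes_vec a + x * (v \<bullet> otimes_vec a)"
proof -
  have "(u @\<^sub>v v) \<bullet> otimes_vec (vCons x a) = u \<bullet> otimes_vec a + v \<bullet> (x \<cdot>\<^sub>v otimes_vec a)"
    using assms otimes_vec_carrier[OF assms(3)]
    by (simp add: scalar_prod_append[where ?n1.0 = "2 ^ p" and ?n2.0 = "2 ^ p"])
  then show ?thesis
    using assms otimes_vec_carrier[OF assms(3)] by simp
qed

text \<open>A function of a sign $x$ is $(f(1) + f(-1))/2 + x\,(f(1) - f(-1))/2$; iterate over the coordinates.\<close>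

lemma sign_function_eq_scalar_prod_otimes:
  fixes f :: "real vec \<Rightarrow> real"
  shows "\<exists>\<beta> \<in> carrier_vec (2 ^ p). \<forall>a \<in> sign_vecs p. f a = \<beta> \<bullet> otimes_vec a"
proof (induction p arbitrary: f)
  case 0
  then show ?case
    by (intro bexI[of _ "vCons (f vNil) vNil"]) (auto simp: sign_vecs_0)
next
  case (Suc p)
  obtain u where u: "u \<in> carrier_vec (2 ^ p)"
    "\<And>a. a \<in> sign_vecs p \<Longrightarrow> (f (vCons 1 a) + f (vCons (-1) a)) / 2 = u \<bullet> otimes_vec a"
    using Suc[of "\<lambda>a. (f (vCons 1 a) + f (vCons (-1) a)) / 2"] by blast
  obtain v where v: "v \<in> carrier_vec (2 ^ p)"
    "\<And>a. a \<in> sign_vecs p \<Longrightarrow> (f (vCons 1 a) - f (vCons (-1) a)) / 2 = v \<bullet> otimes_vec a"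
    using Suc[of "\<lambda>a. (f (vCons 1 a) - f (vCons (-1) a)) / 2"] by blast
  have "f (vCons x a) = (u @\<^sub>v v) \<bullet> otimes_vec (vCons x a)"
    if "x \<in> {-1, 1}" "a \<in> sign_vecs p" for x a
    using that u(1) v(1) sign_vecs_carrier[OF that(2)]
    by (auto simp del: otimes_vec_vCons
        simp: scalar_prod_append_otimes u(2)[symmetric] v(2)[symmetric] field_simps)
  moreover have "u @\<^sub>v v \<in> carrier_vec (2 ^ Suc p)"
    using u v by (auto intro!: carrier_vecI)
  ultimately show ?case
    by (intro bexI[of _ "u @\<^sub>v v"]) (auto simp: sign_vecs_Suc simp del: otimes_vec_vCons)
qed

section \<open>Sylvester matrices and norm bounds\<close>

lemma sylvester_carrier [simp]: "sylvester p \<in> carrier_mat (2 ^ p) (2 ^ p)"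
  by (induction p) (auto simp: mult_2)

text \<open>Upper block rows correspond to first coordinate 1 and lower block rows to first
  coordinate -1; the remaining coordinates come from the induction hypothesis.\<close>

lemma sylvester_row_otimes:
  assumes "i < 2 ^ p"
  shows "\<exists>a \<in> sign_vecs p. row (sylvester p) i = otimes_vec a"
  using assms
proof (induction p arbitrary: i)
  case 0
  then show ?case
    by (auto simp: sign_vecs_0 intro!: eq_vecI)
next
  case (Suc p)
  let ?H = "sylvester p"
  have neg: "- ?H \<in> carrier_mat (2 ^ p) (2 ^ p)"
    by simp
  note row = row_four_block_mat[OF sylvester_carrier sylvester_carrier sylvester_carrier neg]
  show ?case
  proof (cases "i < 2 ^ p")
    case True
    then obtain a where a: "a \<in> sign_vecs p" "row ?H i = otimes_vec a"
      using Suc.IH by blast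
    then have "row (sylvester (Suc p)) i = otimes_vec (vCons 1 a)"
      using row(1)[OF True] by simp
    then show ?thesis
      using a by (intro bexI[of _ "vCons 1 a"]) auto
  next
    case False
    with Suc.prems have i: "i - 2 ^ p < 2 ^ p" "i < 2 ^ p + 2 ^ p"
      by auto
    then obtain a where a: "a \<in> sign_vecs p" "row ?H (i - 2 ^ p) = otimes_vec a"
      using Suc.IH by blast
    \<comment> \<open>The negated block row is written as a scalar multiple by -1 to match the
      recursion \<open>otimes_vec_vCons\<close> with \<open>x = -1\<close>.\<close>
    have "row (- ?H) (i - 2 ^ p) = (-1) \<cdot>\<^sub>v otimes_vec a"
      using i carrier_matD[OF sylvester_carrier[of p]]
      by (subst a(2)[symmetric]) (auto intro!: eq_vecI)
    then have "row (sylvester (Suc p)) i = otimes_vec (vCons (-1) a)"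
      using row(2)[OF False i(2)] a by simp
    then show ?thesis
      using a by (intro bexI[of _ "vCons (-1) a"]) auto
  qed
qed

lemma scalar_prod_parallelogram:
  fixes x y :: "real vec"
  assumes "x \<in> carrier_vec n" "y \<in> carrier_vec n"
  shows "(x + y) \<bullet> (x + y) + (x - y) \<bullet> (x - y) = 2 * (x \<bullet> x + y \<bullet> y)"
  using assms
  by (auto simp: scalar_prod_def sum.distrib[symmetric] sum_distrib_left algebra_simps intro!: sum.cong)

text \<open>Splitting \<beta> into halves \<open>u\<close>, \<open>v\<close> turns its image into
  the sum and the difference of \<open>H u\<close> and \<open>H v\<close>. The parallelogram law
  then contributes a factor 2 at each level of the recursion, so orthogonality of the rows need not
  be proved separately.\<close>

lemma sylvester_parseval:
  assumes "\<beta> \<in> carrier_vec (2 ^ p)"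
  shows "(sylvester p *\<^sub>v \<beta>) \<bullet> (sylvester p *\<^sub>v \<beta>) = 2 ^ p * (\<beta> \<bullet> \<beta>)"
  using assms
proof (induction p arbitrary: \<beta>)
  case 0
  then show ?case
    by simp
next
  case (Suc p)
  let ?H = "sylvester p"
  define u v where "u = vec_first \<beta> (2 ^ p)" and "v = vec_last \<beta> (2 ^ p)"
  have uv: "u \<in> carrier_vec (2 ^ p)" "v \<in> carrier_vec (2 ^ p)" and \<beta>: "\<beta> = u @\<^sub>v v"
    using Suc.prems by (simp_all add: u_def v_def mult_2)
  have Huv: "?H *\<^sub>v u \<in> carrier_vec (2 ^ p)" "?H *\<^sub>v v \<in> carrier_vec (2 ^ p)"
    using uv by (auto intro: mult_mat_vec_carrier[OF sylvester_carrier])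
  have "sylvester (Suc p) *\<^sub>v \<beta> = (?H *\<^sub>v u + ?H *\<^sub>v v) @\<^sub>v (?H *\<^sub>v u + - ?H *\<^sub>v v)"
    unfolding \<beta> sylvester.simps
    by (rule four_block_mat_mult_vec[OF sylvester_carrier sylvester_carrier sylvester_carrier])
      (use uv in auto)
  also have "- ?H *\<^sub>v v = - (?H *\<^sub>v v)"
    using uv(2) carrier_matD[OF sylvester_carrier[of p]] by (intro uminus_mult_mat_vec) simp
  also have "?H *\<^sub>v u + - (?H *\<^sub>v v) = ?H *\<^sub>v u - ?H *\<^sub>v v"
    by (rule minus_add_uminus_vec[OF Huv, symmetric])
  finally have eq: "sylvester (Suc p) *\<^sub>v \<beta> = (?H *\<^sub>v u + ?H *\<^sub>v v) @\<^sub>v (?H *\<^sub>v u - ?H *\<^sub>v v)" .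
  have "(sylvester (Suc p) *\<^sub>v \<beta>) \<bullet> (sylvester (Suc p) *\<^sub>v \<beta>) =
      (?H *\<^sub>v u + ?H *\<^sub>v v) \<bullet> (?H *\<^sub>v u + ?H *\<^sub>v v) + (?H *\<^sub>v u - ?H *\<^sub>v v) \<bullet> (?H *\<^sub>v u - ?H *\<^sub>v v)"
    unfolding eq by (rule scalar_prod_append) (rule add_carrier_vec minus_carrier_vec Huv)+
  also have "\<dots> = 2 * (2 ^ p * (u \<bullet> u) + 2 ^ p * (v \<bullet> v))"
    unfolding scalar_prod_parallelogram[OF Huv] Suc.IH[OF uv(1)] Suc.IH[OF uv(2)] ..
  also have "\<dots> = 2 ^ Suc p * (\<beta> \<bullet> \<beta>)"
    unfolding \<beta> scalar_prod_append[OF uv uv] by (simp add: algebra_simps)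
  finally show ?case .
qed

text \<open>Each entry of the product pairs \<beta> with a row of the matrix, and each row is the
  Kronecker power of a sign vector.\<close>

lemma sylvester_mult_abs_le:
  assumes \<beta>: "\<beta> \<in> carrier_vec (2 ^ p)"
    and bound: "\<And>a. a \<in> sign_vecs p \<Longrightarrow> \<bar>\<beta> \<bullet> otimes_vec a\<bar> \<le> c"
    and i: "i < 2 ^ p"
  shows "\<bar>(sylvester p *\<^sub>v \<beta>) $ i\<bar> \<le> c"
proof -
  obtain a where a: "a \<in> sign_vecs p" "row (sylvester p) i = otimes_vec a"
    using sylvester_row_otimes[OF i] by blast
  have "(sylvester p *\<^sub>v \<beta>) $ i = otimes_vec a \<bullet> \<beta>"
    using i a carrier_matD[OF sylvester_carrier[of p]] by simp
  also have "\<dots> = \<beta> \<bullet> otimes_vec a"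
    by (rule comm_scalar_prod[OF sign_vecs_otimes_carrier[OF a(1)] \<beta>])
  finally show ?thesis
    using bound a by simp
qed

lemma linf_norm_sylvester_le:
  assumes "\<beta> \<in> carrier_vec (2 ^ p)" "\<And>a. a \<in> sign_vecs p \<Longrightarrow> \<bar>\<beta> \<bullet> otimes_vec a\<bar> \<le> c"
  shows "linf_norm_vec (sylvester p *\<^sub>v \<beta>) \<le> c"
proof -
  have [simp]: "dim_row (sylvester p) = 2 ^ p"
    using sylvester_carrier by blast
  show ?thesis
    \<comment> \<open>\<open>Max_le_iff\<close> requires a nonempty set; there are
      \<open>2 ^ p > 0\<close> indices.\<close>
    unfolding linf_norm_vec_def using sylvester_mult_abs_le[OF assms]
    by (subst Max_le_iff) (auto simp: lessThan_empty_iff simp del: index_mult_mat_vec)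
qed

text \<open>By Parseval, \<open>2 ^ p\<close> times the squared norm of \<beta> is a sum of
  \<open>2 ^ p\<close> squares, each at most 1.\<close>

lemma l2_norm_le_if_otimes_bounded:
  assumes \<beta>: "\<beta> \<in> carrier_vec (2 ^ p)"
    and bound: "\<And>a. a \<in> sign_vecs p \<Longrightarrow> \<bar>\<beta> \<bullet> otimes_vec a\<bar> \<le> 1"
  shows "l2_norm_vec \<beta> \<le> 1"
proof -
  let ?y = "sylvester p *\<^sub>v \<beta>"
  have dim: "dim_vec ?y = 2 ^ p"
    using sylvester_carrier[of p] by (metis carrier_matD(1) dim_mult_mat_vec)
  have "2 ^ p * (\<beta> \<bullet> \<beta>) = (\<Sum>i = 0..<2 ^ p. (?y $ i)\<^sup>2)"
    using sylvester_parseval[OF \<beta>] dim by (simp add: scalar_prod_def power2_eq_square)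
  also have "\<dots> \<le> (\<Sum>i = 0..<(2::nat) ^ p. 1)"
    using sylvester_mult_abs_le[OF \<beta> bound]
    by (intro sum_mono) (simp add: abs_square_le_1 del: index_mult_mat_vec)
  finally have "\<beta> \<bullet> \<beta> \<le> 1"
    by simp
  moreover have "l2_norm_vec \<beta> = sqrt (\<beta> \<bullet> \<beta>)"
    by (simp add: l2_norm_vec_def L2_set_def scalar_prod_def power2_eq_square atLeast0LessThan)
  ultimately show ?thesis
    by simp
qed

section \<open>Expectations and covariances of finitely valued variables\<close>

lemma (in finite_measure) integrable_finite_valued:
  fixes f :: "'b \<Rightarrow> real"
  assumes X: "X \<in> M \<rightarrow>\<^sub>M count_space S" and S: "finite S"
  shows "integrable M (\<lambda>w. f (X w))"
proof (rule integrable_const_bound)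
  show "AE w in M. norm (f (X w)) \<le> Max ((\<lambda>s. \<bar>f s\<bar>) ` S)"
    using S measurable_space[OF X] by (intro AE_I2) (auto intro!: Max_ge)
  show "(\<lambda>w. f (X w)) \<in> borel_measurable M"
    using X by (rule measurable_compose) simp
qed

text \<open>The pair \<open>(X w, Y w)\<close> is again finitely valued, and the product is a
  function of it.\<close>

lemma (in finite_measure) integrable_mult_finite_valued:
  fixes f :: "'b \<Rightarrow> real" and g :: "'c \<Rightarrow> real"
  assumes X: "X \<in> M \<rightarrow>\<^sub>M count_space S" "finite S"
    and Y: "Y \<in> M \<rightarrow>\<^sub>M count_space T" "finite T"
  shows "integrable M (\<lambda>w. f (X w) * g (Y w))"
proof -
  have "(\<lambda>w. (X w, Y w)) \<in> M \<rightarrow>\<^sub>M count_space (S \<times> T)"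
    using measurable_Pair[OF X(1) Y(1)] pair_measure_count_space[OF X(2) Y(2)] by simp
  from integrable_finite_valued[OF this finite_cartesian_product[OF X(2) Y(2)], of "\<lambda>(s, t). f s * g t"]
  show ?thesis
    by simp
qed

lemma (in prob_space) covariance_eq:
  assumes "integrable M X" "integrable M Y" "integrable M (\<lambda>w. X w * Y w)"
  shows "covariance M X Y = expectation (\<lambda>w. X w * Y w) - expectation X * expectation Y"
proof -
  have "covariance M X Y = expectation (\<lambda>w. X w * Y w - expectation X * Y w - expectation Y * X w
      + expectation X * expectation Y)"
    unfolding covariance_def by (rule Bochner_Integration.integral_cong) (auto simp: algebra_simps)
  also have "\<dots> = expectation (\<lambda>w. X w * Y w) - expectation X * expectation Y
      - expectation Y * expectation X + expectation X * expectation Y"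
    using assms by (simp add: prob_space)
  finally show ?thesis
    by (simp add: mult.commute)
qed

lemma (in prob_space) covariance_finite_valued:
  fixes f :: "'b \<Rightarrow> real" and g :: "'c \<Rightarrow> real"
  assumes X: "X \<in> M \<rightarrow>\<^sub>M count_space S" "finite S"
    and Y: "Y \<in> M \<rightarrow>\<^sub>M count_space T" "finite T"
  shows "covariance M (\<lambda>w. f (X w)) (\<lambda>w. g (Y w)) =
    expectation (\<lambda>w. f (X w) * g (Y w)) - expectation (\<lambda>w. f (X w)) * expectation (\<lambda>w. g (Y w))"
  by (rule covariance_eq[OF integrable_finite_valued[OF X] integrable_finite_valued[OF Y]
        integrable_mult_finite_valued[OF X Y]])

lemma scalar_prod_otimes_eq_sum:
  "a \<in> sign_vecs p \<Longrightarrow> \<beta> \<bullet> otimes_vec a = (\<Sum>i<2 ^ p. \<beta> $ i * otimes_vec a $ i)"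
  unfolding scalar_prod_def carrier_vecD[OF sign_vecs_otimes_carrier] atLeast0LessThan ..

lemma (in prob_space) expectation_scalar_prod_otimes:
  assumes A: "A \<in> M \<rightarrow>\<^sub>M count_space (sign_vecs p)"
  shows "expectation (\<lambda>w. \<beta> \<bullet> otimes_vec (A w)) =
    (\<Sum>i<2 ^ p. \<beta> $ i * expectation (\<lambda>w. otimes_vec (A w) $ i))"
proof -
  have "expectation (\<lambda>w. \<beta> \<bullet> otimes_vec (A w)) =
      expectation (\<lambda>w. \<Sum>i<2 ^ p. \<beta> $ i * otimes_vec (A w) $ i)"
    using measurable_space[OF A]
    by (intro Bochner_Integration.integral_cong) (simp_all add: scalar_prod_otimes_eq_sum)
  moreover have "integrable M (\<lambda>w. otimes_vec (A w) $ i)" for i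
    using integrable_finite_valued[OF A finite_sign_vecs, of "\<lambda>a. otimes_vec a $ i"] .
  ultimately show ?thesis
    by (simp add: Bochner_Integration.integral_sum)
qed

text \<open>The general factor \<open>f (B w)\<close> serves three purposes: a linear form in the
  other random vector, a single coordinate of the other Kronecker power, and, with both variables
  equal, a coordinate of the same power when the Gram matrix is applied.\<close>

lemma (in prob_space) expectation_mult_scalar_prod_otimes:
  assumes A: "A \<in> M \<rightarrow>\<^sub>M count_space (sign_vecs p)" and B: "B \<in> M \<rightarrow>\<^sub>M count_space T" "finite T"
  shows "expectation (\<lambda>w. f (B w) * (\<beta> \<bullet> otimes_vec (A w))) =
    (\<Sum>i<2 ^ p. expectation (\<lambda>w. f (B w) * otimes_vec (A w) $ i) * \<beta> $ i)"
proof -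
  have "f (B w) * (\<beta> \<bullet> otimes_vec (A w)) = (\<Sum>i<2 ^ p. (f (B w) * otimes_vec (A w) $ i) * \<beta> $ i)"
    if "w \<in> space M" for w
  proof -
    have "A w \<in> sign_vecs p"
      using measurable_space[OF A that] by simp
    then show ?thesis
      by (subst scalar_prod_otimes_eq_sum) (auto simp: sum_distrib_left intro!: sum.cong)
  qed
  then have "expectation (\<lambda>w. f (B w) * (\<beta> \<bullet> otimes_vec (A w))) =
      expectation (\<lambda>w. \<Sum>i<2 ^ p. (f (B w) * otimes_vec (A w) $ i) * \<beta> $ i)"
    by (intro Bochner_Integration.integral_cong) simp_all
  moreover have "integrable M (\<lambda>w. f (B w) * otimes_vec (A w) $ i)" for i
    using integrable_mult_finite_valued[OF B A finite_sign_vecs, of f "\<lambda>a. otimes_vec a $ i"] .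
  ultimately show ?thesis
    by (simp add: Bochner_Integration.integral_sum)
qed

section \<open>Independence and vanishing covariances\<close>

text \<open>Functions of independent variables are independent, so the expectation of their product
  factors.\<close>

lemma (in prob_space) indep_var_imp_covariance_zero:
  fixes f g :: "'b \<Rightarrow> real"
  assumes ind: "indep_var (count_space S) A (count_space T) B" and fin: "finite S" "finite T"
  shows "covariance M (\<lambda>w. f (A w)) (\<lambda>w. g (B w)) = 0"
proof -
  note rv = indep_var_rv1[OF ind] indep_var_rv2[OF ind]
  have int: "integrable M (\<lambda>w. f (A w))" "integrable M (\<lambda>w. g (B w))"
    using rv fin by (auto intro: integrable_finite_valued)
  have "indep_var borel (f \<circ> A) borel (g \<circ> B)"
    by (rule indep_var_compose[OF ind]) auto
  then have "expectation (\<lambda>w. f (A w) * g (B w)) =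
      expectation (\<lambda>w. f (A w)) * expectation (\<lambda>w. g (B w))"
    using int indep_var_lebesgue_integral[of "f \<circ> A" "g \<circ> B"] by (simp add: comp_def)
  then show ?thesis
    by (simp add: covariance_finite_valued[OF rv(1) fin(1) rv(2) fin(2)])
qed

text \<open>Indicators of events about $A$ are linear in the coordinates of its Kronecker power, so the
  product formula for probabilities is the bilinear extension of the vanishing covariances.\<close>

lemma (in prob_space) indep_var_if_covariance_zero:
  assumes A: "A \<in> M \<rightarrow>\<^sub>M count_space (sign_vecs p)" and B: "B \<in> M \<rightarrow>\<^sub>M count_space (sign_vecs q)"
    and cov: "\<And>i j. i < 2 ^ p \<Longrightarrow> j < 2 ^ q \<Longrightarrow>
      covariance M (\<lambda>w. otimes_vec (A w) $ i) (\<lambda>w. otimes_vec (B w) $ j) = 0"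
  shows "indep_var (count_space (sign_vecs p)) A (count_space (sign_vecs q)) B"
proof -
  have uncor: "expectation (\<lambda>w. otimes_vec (A w) $ i * otimes_vec (B w) $ j) =
      expectation (\<lambda>w. otimes_vec (A w) $ i) * expectation (\<lambda>w. otimes_vec (B w) $ j)"
    if "i < 2 ^ p" "j < 2 ^ q" for i j
    using cov[OF that]
      covariance_finite_valued[OF A finite_sign_vecs B finite_sign_vecs,
        of "\<lambda>a. otimes_vec a $ i" "\<lambda>b. otimes_vec b $ j"]
    by simp
  have prod: "prob (A -` S \<inter> space M \<inter> (B -` T \<inter> space M)) =
      prob (A -` S \<inter> space M) * prob (B -` T \<inter> space M)"
    if "S \<subseteq> sign_vecs p" "T \<subseteq> sign_vecs q" for S T
  proof -
    obtain u where u: "u \<in> carrier_vec (2 ^ p)"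
      "\<And>a. a \<in> sign_vecs p \<Longrightarrow> indicator S a = u \<bullet> otimes_vec a"
      using sign_function_eq_scalar_prod_otimes[of p "indicator S"] by blast
    obtain v where v: "v \<in> carrier_vec (2 ^ q)"
      "\<And>b. b \<in> sign_vecs q \<Longrightarrow> indicator T b = v \<bullet> otimes_vec b"
      using sign_function_eq_scalar_prod_otimes[of q "indicator T"] by blast
    have iA: "indicator (A -` S \<inter> space M) w = u \<bullet> otimes_vec (A w)"
      and iB: "indicator (B -` T \<inter> space M) w = v \<bullet> otimes_vec (B w)" if "w \<in> space M" for w
      using that measurable_space[OF A that] measurable_space[OF B that]
      by (auto simp: u(2)[symmetric] v(2)[symmetric] indicator_def)
    have events: "A -` S \<inter> space M \<in> events" "B -` T \<inter> space M \<in> events"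
      using that measurable_sets[OF A] measurable_sets[OF B] by simp_all
    have "prob (A -` S \<inter> space M \<inter> (B -` T \<inter> space M)) =
        expectation (\<lambda>w. indicator (A -` S \<inter> space M \<inter> (B -` T \<inter> space M)) w)"
      using events by simp
    also have "\<dots> = expectation (\<lambda>w. (u \<bullet> otimes_vec (A w)) * (v \<bullet> otimes_vec (B w)))"
      by (rule Bochner_Integration.integral_cong) (simp_all add: indicator_inter_arith flip: iA iB)
    \<comment> \<open>Bilinearity is used one argument at a time: first the form in \<open>B\<close>
      is expanded, then the form in \<open>A\<close> inside each summand, where \<open>uncor\<close>
      applies.\<close>
    also have "\<dots> = (\<Sum>j<2 ^ q. expectation (\<lambda>w. (u \<bullet> otimes_vec (A w)) * otimes_vec (B w) $ j) * v $ j)"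
      by (rule expectation_mult_scalar_prod_otimes[OF B A finite_sign_vecs])
    also have "\<dots> = (\<Sum>j<2 ^ q. (expectation (\<lambda>w. u \<bullet> otimes_vec (A w)) *
        expectation (\<lambda>w. otimes_vec (B w) $ j)) * v $ j)"
    proof (rule sum.cong)
      fix j assume j: "j \<in> {..<(2::nat) ^ q}"
      have "expectation (\<lambda>w. (u \<bullet> otimes_vec (A w)) * otimes_vec (B w) $ j) =
          expectation (\<lambda>w. otimes_vec (B w) $ j * (u \<bullet> otimes_vec (A w)))"
        by (simp add: mult.commute)
      also have "\<dots> = (\<Sum>i<2 ^ p. expectation (\<lambda>w. otimes_vec (B w) $ j * otimes_vec (A w) $ i) * u $ i)"
        by (rule expectation_mult_scalar_prod_otimes[OF A B finite_sign_vecs])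
      also have "\<dots> = (\<Sum>i<2 ^ p. u $ i * expectation (\<lambda>w. otimes_vec (A w) $ i)) *
          expectation (\<lambda>w. otimes_vec (B w) $ j)"
        using j uncor by (simp add: sum_distrib_left mult.commute mult.left_commute)
      finally show "expectation (\<lambda>w. (u \<bullet> otimes_vec (A w)) * otimes_vec (B w) $ j) * v $ j =
          (expectation (\<lambda>w. u \<bullet> otimes_vec (A w)) * expectation (\<lambda>w. otimes_vec (B w) $ j)) * v $ j"
        by (simp only: expectation_scalar_prod_otimes[OF A])
    qed simp
    also have "\<dots> = expectation (\<lambda>w. u \<bullet> otimes_vec (A w)) * expectation (\<lambda>w. v \<bullet> otimes_vec (B w))"
      by (simp add: expectation_scalar_prod_otimes[OF B] sum_distrib_left mult_ac)
    also have "expectation (\<lambda>w. u \<bullet> otimes_vec (A w)) = expectation (indicator (A -` S \<inter> space M))"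
      by (rule Bochner_Integration.integral_cong) (simp_all add: iA)
    also have "expectation (\<lambda>w. v \<bullet> otimes_vec (B w)) = expectation (indicator (B -` T \<inter> space M))"
      by (rule Bochner_Integration.integral_cong) (simp_all add: iB)
    finally show ?thesis
      using events by simp
  qed
  \<comment> \<open>\<open>indep_var_eq\<close> asks for independence of the sigma-algebras
    generated by these preimages. Closure under intersections lets the product formula pass to
    them.\<close>
  have "indep_set {A -` S \<inter> space M |S. S \<in> sets (count_space (sign_vecs p))}
      {B -` T \<inter> space M |T. T \<in> sets (count_space (sign_vecs q))}"
    unfolding indep_sets2_eq
    using prod measurable_sets[OF A] measurable_sets[OF B] by (safe; simp)
  moreover have "Int_stable {X -` S \<inter> space M |S. S \<in> sets (count_space C)}"
    for X :: "'a \<Rightarrow> real vec" and C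
    unfolding Int_stable_def
  proof (safe, goal_cases)
    case (1 _ _ S T)
    then show ?case
      by (intro exI[of _ "S \<inter> T"]) auto
  qed
  ultimately show ?thesis
    unfolding indep_var_eq using A B indep_set_sigma_sets by simp
qed

section \<open>The sigma-algebra generated by a sign vector and conditional expectation\<close>

lemma space_gen_algebra [simp]: "space (gen_algebra M p A) = space M"
  by (simp add: gen_algebra_def)

lemma sets_gen_algebra:
  assumes "A \<in> M \<rightarrow>\<^sub>M count_space (sign_vecs p)"
  shows "sets (gen_algebra M p A) = {A -` S \<inter> space M |S. S \<subseteq> sign_vecs p}"
  using measurable_space[OF assms] unfolding gen_algebra_def
  by (subst sets_vimage_algebra2) auto

lemma measurable_gen_algebra:
  assumes "A \<in> M \<rightarrow>\<^sub>M count_space (sign_vecs p)"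
  shows "A \<in> gen_algebra M p A \<rightarrow>\<^sub>M count_space (sign_vecs p)"
  using measurable_space[OF assms] unfolding gen_algebra_def
  by (intro measurable_vimage_algebra1) auto

lemma (in prob_space) finite_measure_subalgebra_gen_algebra:
  assumes "A \<in> M \<rightarrow>\<^sub>M count_space (sign_vecs p)"
  shows "finite_measure_subalgebra M (gen_algebra M p A)"
proof
  show "subalgebra M (gen_algebra M p A)"
    using measurable_sets[OF assms] by (auto simp: subalgebra_def sets_gen_algebra[OF assms])
qed

text \<open>A Doob-Dynkin factorisation: level sets of \<open>g\<close> are preimages under
  \<open>A\<close>, so \<open>g\<close> is constant on each fibre of \<open>A\<close>.\<close>

lemma gen_algebra_measurable_factor:
  fixes g :: "'a \<Rightarrow> real"
  assumes A: "A \<in> M \<rightarrow>\<^sub>M count_space (sign_vecs p)"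
    and g: "g \<in> borel_measurable (gen_algebra M p A)"
  obtains f where "\<And>w. w \<in> space M \<Longrightarrow> g w = f (A w)"
proof
  fix w assume w: "w \<in> space M"
  \<comment> \<open>The representative of the fibre depends on \<open>w\<close> only through
    \<open>A w\<close>, so \<open>g w'\<close> is a function of \<open>A w\<close>.\<close>
  define w' where "w' = (SOME w'. w' \<in> space M \<and> A w' = A w)"
  have w': "w' \<in> space M" "A w' = A w"
    using someI[of "\<lambda>w'. w' \<in> space M \<and> A w' = A w" w] w unfolding w'_def by auto
  have "g -` {g w} \<inter> space M \<in> sets (gen_algebra M p A)"
    using measurable_sets[OF g, of "{g w}"] by simp
  then obtain S where "g -` {g w} \<inter> space M = A -` S \<inter> space M"
    by (auto simp: sets_gen_algebra[OF A])
  then have "w' \<in> g -` {g w}"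
    using w w' by auto
  then show "g w = (\<lambda>a. g (SOME w'. w' \<in> space M \<and> A w' = a)) (A w)"
    by (simp add: w'_def)
qed

text \<open>The identity holds at every point because the version \<open>real_cond_exp\<close> is
  itself measurable for the generated sigma-algebra and therefore factors exactly through
  \<open>A\<close>.\<close>

lemma (in prob_space) cond_exp_eq_scalar_prod_otimes:
  assumes A: "A \<in> M \<rightarrow>\<^sub>M count_space (sign_vecs p)"
  shows "\<exists>\<beta> \<in> carrier_vec (2 ^ p).
    \<forall>w \<in> space M. real_cond_exp M (gen_algebra M p A) B w = \<beta> \<bullet> otimes_vec (A w)"
proof -
  obtain f where f: "\<And>w. w \<in> space M \<Longrightarrow> real_cond_exp M (gen_algebra M p A) B w = f (A w)"
    using gen_algebra_measurable_factor[OF A borel_measurable_cond_exp] by blast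
  obtain \<beta> where "\<beta> \<in> carrier_vec (2 ^ p)" "\<And>a. a \<in> sign_vecs p \<Longrightarrow> f a = \<beta> \<bullet> otimes_vec a"
    using sign_function_eq_scalar_prod_otimes[of p f] by blast
  then show ?thesis
    using f measurable_space[OF A] by auto
qed

section \<open>The Gram matrix and the regression coefficients\<close>

text \<open>Links the existential \<open>invertible_mat\<close> to the computed
  \<open>mat_inverse\<close>: an invertible matrix is a unit of the matrix ring, which excludes the
  result \<open>None\<close>.\<close>

lemma the_mat_inverse_mult_vec:
  fixes G :: "'a :: field mat"
  assumes G: "G \<in> carrier_mat n n" and inv: "invertible_mat G" and v: "v \<in> carrier_vec n"
  shows "the (mat_inverse G) *\<^sub>v (G *\<^sub>v v) = v"
proof -
  obtain B where B: "G * B = 1\<^sub>m n" "B * G = 1\<^sub>m (dim_row B)"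
    using inv G by (auto simp: invertible_mat_def inverts_mat_def)
  \<comment> \<open>The dimensions of the inverse are not part of \<open>invertible_mat\<close>;
    comparing column counts in the two product equations yields them.\<close>
  have "dim_col B = n" "dim_row B = n"
    using arg_cong[OF B(1), of dim_col] arg_cong[OF B(2), of dim_col] G by auto
  then have "G \<in> Units (ring_mat TYPE('a) n ())"
    using B G by (auto simp: Units_def ring_mat_def intro!: exI[of _ B])
  then obtain C where C: "mat_inverse G = Some C"
    using mat_inverse(1)[OF G, where b = "()"] by (cases "mat_inverse G") auto
  then have "C * G = 1\<^sub>m n" "C \<in> carrier_mat n n"
    using mat_inverse(2)[OF G] by auto
  then show ?thesis
    using C G v by (simp flip: assoc_mult_mat_vec)
qed

lemma outer_prod_index [simp]:
  "i < dim_vec u \<Longrightarrow> j < dim_vec v \<Longrightarrow> outer_prod u v $$ (i, j) = u $ i * v $ j"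
  by (simp add: outer_prod_def scalar_prod_def mat_of_row_def)

text \<open>Being an input abbreviation, it lets the lemmas match the matrix in the theorem without
  unfolding.\<close>

abbreviation (input) gram :: "'a measure \<Rightarrow> nat \<Rightarrow> ('a \<Rightarrow> real vec) \<Rightarrow> real mat" where
  "gram M p A \<equiv> expect_mat M (2 ^ p) (2 ^ p) (\<lambda>w. outer_prod (otimes_vec (A w)) (otimes_vec (A w)))"

lemma gram_carrier: "gram M p A \<in> carrier_mat (2 ^ p) (2 ^ p)"
  by (simp add: expect_mat_def)

context prob_space
begin

text \<open>Linearity of expectation moves \<beta> inside the integral. Both the kernel argument and
  the normal equations rest on this form.\<close>

lemma gram_mult_index:
  assumes A: "A \<in> M \<rightarrow>\<^sub>M count_space (sign_vecs p)" and \<beta>: "\<beta> \<in> carrier_vec (2 ^ p)" and i: "i < 2 ^ p"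
  shows "(gram M p A *\<^sub>v \<beta>) $ i = expectation (\<lambda>w. otimes_vec (A w) $ i * (\<beta> \<bullet> otimes_vec (A w)))"
proof -
  have "dim_vec (otimes_vec (A w)) = 2 ^ p" if "w \<in> space M" for w
    using measurable_space[OF A that] carrier_vecD[OF sign_vecs_otimes_carrier] by simp
  then have G: "gram M p A $$ (i, j) = expectation (\<lambda>w. otimes_vec (A w) $ i * otimes_vec (A w) $ j)"
    if "j < 2 ^ p" for j
    using that i by (auto simp: expect_mat_def intro!: Bochner_Integration.integral_cong)
  have "(gram M p A *\<^sub>v \<beta>) $ i = (\<Sum>j<2 ^ p. gram M p A $$ (i, j) * \<beta> $ j)"
    using i \<beta> carrier_matD[OF gram_carrier[of M p A]]
    by (simp add: scalar_prod_def atLeast0LessThan)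
  also have "\<dots> = (\<Sum>j<2 ^ p. expectation (\<lambda>w. otimes_vec (A w) $ i * otimes_vec (A w) $ j) * \<beta> $ j)"
    using G by simp
  also have "\<dots> = expectation (\<lambda>w. otimes_vec (A w) $ i * (\<beta> \<bullet> otimes_vec (A w)))"
    by (rule expectation_mult_scalar_prod_otimes[OF A A finite_sign_vecs, symmetric])
  finally show ?thesis .
qed

text \<open>If the value $a$ had probability zero, the coefficient vector of its indicator would lie in the
  kernel of the Gram matrix.\<close>

lemma not_AE_neq_if_gram_invertible:
  assumes A: "A \<in> M \<rightarrow>\<^sub>M count_space (sign_vecs p)" and inv: "invertible_mat (gram M p A)"
    and a: "a \<in> sign_vecs p"
  shows "\<not> (AE w in M. A w \<noteq> a)"
proof
  assume ae: "AE w in M. A w \<noteq> a"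
  obtain \<beta> where \<beta>: "\<beta> \<in> carrier_vec (2 ^ p)"
    "\<And>b. b \<in> sign_vecs p \<Longrightarrow> indicator {a} b = \<beta> \<bullet> otimes_vec b"
    using sign_function_eq_scalar_prod_otimes[of p "indicator {a}"] by blast
  \<comment> \<open>The linear form equals the indicator of \<open>a\<close> at \<open>A w\<close>,
    which vanishes almost everywhere by assumption.\<close>
  have zero: "AE w in M. otimes_vec (A w) $ i * (\<beta> \<bullet> otimes_vec (A w)) = 0" for i
    using ae AE_space
  proof eventually_elim
    case (elim w)
    then show ?case
      using \<beta>(2)[OF measurable_space[OF A, simplified], of w] by simp
  qed
  have "gram M p A *\<^sub>v \<beta> = 0\<^sub>v (2 ^ p)"
  proof (rule eq_vecI)
    fix i assume "i < dim_vec (0\<^sub>v (2 ^ p) :: real vec)"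
    then show "(gram M p A *\<^sub>v \<beta>) $ i = 0\<^sub>v (2 ^ p) $ i"
      using gram_mult_index[OF A \<beta>(1)] integral_eq_zero_AE[OF zero] by simp
  qed (simp add: expect_mat_def)
  moreover have "gram M p A *\<^sub>v 0\<^sub>v (2 ^ p) = 0\<^sub>v (2 ^ p)"
    using carrier_matD[OF gram_carrier[of M p A]]
    by (intro eq_vecI) (auto simp: scalar_prod_def)
  ultimately have "\<beta> = 0\<^sub>v (2 ^ p)"
    using the_mat_inverse_mult_vec[OF gram_carrier inv \<beta>(1)]
      the_mat_inverse_mult_vec[OF gram_carrier inv zero_carrier_vec]
    by simp
  \<comment> \<open>At \<open>a\<close> itself the linear form takes the value 1, so its
    coefficients cannot all be zero.\<close>
  then show False
    using \<beta>(2)[OF a] sign_vecs_otimes_carrier[OF a] by simp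
qed

text \<open>Conditional expectation inherits the bounds of \<open>B\<close> almost everywhere. A
  violation at \<open>a\<close> would make the event \<open>A w = a\<close> null, which
  invertibility excludes; hence the bound reaches every sign vector.\<close>

lemma cond_exp_coefficients_bounded:
  assumes A: "A \<in> M \<rightarrow>\<^sub>M count_space (sign_vecs p)" and inv: "invertible_mat (gram M p A)"
    and B: "integrable M B" "AE w in M. \<bar>B w\<bar> \<le> c"
    and eq: "AE w in M. real_cond_exp M (gen_algebra M p A) B w = \<beta> \<bullet> otimes_vec (A w)"
    and a: "a \<in> sign_vecs p"
  shows "\<bar>\<beta> \<bullet> otimes_vec a\<bar> \<le> c"
proof (rule ccontr)
  assume contr: "\<not> \<bar>\<beta> \<bullet> otimes_vec a\<bar> \<le> c"
  interpret F: finite_measure_subalgebra M "gen_algebra M p A"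
    by (rule finite_measure_subalgebra_gen_algebra[OF A])
  have "AE w in M. B w \<le> c" "AE w in M. - c \<le> B w"
    using B(2) by (auto elim!: eventually_mono)
  then have "AE w in M. real_cond_exp M (gen_algebra M p A) B w \<le> c"
    "AE w in M. - c \<le> real_cond_exp M (gen_algebra M p A) B w"
    using F.real_cond_exp_le_c[OF B(1)] F.real_cond_exp_ge_c[OF B(1)] by auto
  then have "AE w in M. A w \<noteq> a"
    using eq by eventually_elim (use contr in auto)
  then show False
    using not_AE_neq_if_gram_invertible[OF A inv a] by simp
qed

text \<open>These are the normal equations of the regression of \<open>B\<close> on the Kronecker
  power of \<open>A\<close>.\<close>

lemma gram_mult_cond_exp_coefficients:
  assumes A: "A \<in> M \<rightarrow>\<^sub>M count_space (sign_vecs p)" and B: "B \<in> M \<rightarrow>\<^sub>M count_space T" "finite T"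
    and \<beta>: "\<beta> \<in> carrier_vec (2 ^ p)"
    and eq: "AE w in M. real_cond_exp M (gen_algebra M p A) B w = \<beta> \<bullet> otimes_vec (A w)"
  shows "gram M p A *\<^sub>v \<beta> = expect_vec M (2 ^ p) (\<lambda>w. B w \<cdot>\<^sub>v otimes_vec (A w))"
proof (rule eq_vecI)
  interpret F: finite_measure_subalgebra M "gen_algebra M p A"
    by (rule finite_measure_subalgebra_gen_algebra[OF A])
  fix i assume "i < dim_vec (expect_vec M (2 ^ p) (\<lambda>w. B w \<cdot>\<^sub>v otimes_vec (A w)))"
  then have i: "i < 2 ^ p"
    by (simp add: expect_vec_def)
  have Ai: "(\<lambda>w. otimes_vec (A w) $ i) \<in> borel_measurable (gen_algebra M p A)"
    by (rule measurable_compose[OF measurable_gen_algebra[OF A]]) simp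
  have Bm: "B \<in> borel_measurable M"
    using measurable_compose[OF B(1), of "\<lambda>x. x" borel] by simp
  have bm: "(\<lambda>w. \<beta> \<bullet> otimes_vec (A w)) \<in> borel_measurable M"
    "(\<lambda>w. otimes_vec (A w) $ i) \<in> borel_measurable M"
    by (rule measurable_compose[OF A]; simp)+
  have "(gram M p A *\<^sub>v \<beta>) $ i = expectation (\<lambda>w. otimes_vec (A w) $ i * (\<beta> \<bullet> otimes_vec (A w)))"
    by (rule gram_mult_index[OF A \<beta> i])
  also have "\<dots> = expectation (\<lambda>w. otimes_vec (A w) $ i * real_cond_exp M (gen_algebra M p A) B w)"
    by (rule integral_cong_AE) (use eq bm in auto)
  \<comment> \<open>The coordinate is measurable for the generated sigma-algebra, so under the
    integral the conditional expectation may be replaced by \<open>B\<close>.\<close>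
  also have "\<dots> = expectation (\<lambda>w. otimes_vec (A w) $ i * B w)"
    by (rule F.real_cond_exp_intg(2)[OF integrable_mult_finite_valued[OF A finite_sign_vecs B, of _ "\<lambda>x. x"] Ai Bm])
  also have "\<dots> = expectation (\<lambda>w. (B w \<cdot>\<^sub>v otimes_vec (A w)) $ i)"
  proof (rule Bochner_Integration.integral_cong)
    fix w assume "w \<in> space M"
    then have "dim_vec (otimes_vec (A w)) = 2 ^ p"
      using measurable_space[OF A] carrier_vecD[OF sign_vecs_otimes_carrier] by simp
    with i have "i < dim_vec (otimes_vec (A w))"
      by (simp only:)
    then show "otimes_vec (A w) $ i * B w = (B w \<cdot>\<^sub>v otimes_vec (A w)) $ i"
      by simp
  qed simp
  finally show "(gram M p A *\<^sub>v \<beta>) $ i = expect_vec M (2 ^ p) (\<lambda>w. B w \<cdot>\<^sub>v otimes_vec (A w)) $ i"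
    using i by (simp add: expect_vec_def)
qed (simp add: expect_mat_def expect_vec_def)

end

theorem theorem2p1:
  fixes M :: "'a measure"
  assumes "prob_space M"
  shows
    "(\<forall>p1 p2. \<forall>A \<in> M \<rightarrow>\<^sub>M count_space (sign_vecs p1). \<forall>B \<in> M \<rightarrow>\<^sub>M count_space (sign_vecs p2).
        prob_space.indep_var M (count_space (sign_vecs p1)) A (count_space (sign_vecs p2)) B
        \<longleftrightarrow>
        (\<forall>i < 2 ^ p1. \<forall>j < 2 ^ p2.
           covariance M (\<lambda>w. otimes_vec (A w) $ i) (\<lambda>w. otimes_vec (B w) $ j) = 0))
     \<and>
     (\<forall>p. \<forall>A \<in> M \<rightarrow>\<^sub>M count_space (sign_vecs p). \<forall>B \<in> M \<rightarrow>\<^sub>M count_space {-1, 1 :: real}.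
        \<exists>\<beta> \<in> carrier_vec (2 ^ p).
          AE w in M. real_cond_exp M (gen_algebra M p A) B w = \<beta> \<bullet> otimes_vec (A w))
     \<and>
     (\<forall>p. \<forall>A \<in> M \<rightarrow>\<^sub>M count_space (sign_vecs p). \<forall>B \<in> M \<rightarrow>\<^sub>M count_space {-1, 1 :: real}.
      \<forall>\<beta> \<in> carrier_vec (2 ^ p).
        (AE w in M. real_cond_exp M (gen_algebra M p A) B w = \<beta> \<bullet> otimes_vec (A w)) \<longrightarrow>
        (let G = expect_mat M (2 ^ p) (2 ^ p) (\<lambda>w. outer_prod (otimes_vec (A w)) (otimes_vec (A w)))
         in invertible_mat G \<longrightarrow>
            \<beta> = the (mat_inverse G) *\<^sub>v expect_vec M (2 ^ p) (\<lambda>w. B w \<cdot>\<^sub>v otimes_vec (A w)) \<and>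
            (\<forall>w \<in> space M. \<bar>\<beta> \<bullet> otimes_vec (A w)\<bar> \<le> 1) \<and>
            linf_norm_vec (sylvester p *\<^sub>v \<beta>) \<le> 1 \<and>
            l2_norm_vec \<beta> \<le> 1))"
proof (intro conjI allI ballI impI)
  interpret prob_space M
    by fact
  show "indep_var (count_space (sign_vecs p1)) A (count_space (sign_vecs p2)) B \<longleftrightarrow>
      (\<forall>i < 2 ^ p1. \<forall>j < 2 ^ p2.
        covariance M (\<lambda>w. otimes_vec (A w) $ i) (\<lambda>w. otimes_vec (B w) $ j) = 0)"
    if "A \<in> M \<rightarrow>\<^sub>M count_space (sign_vecs p1)" "B \<in> M \<rightarrow>\<^sub>M count_space (sign_vecs p2)" for p1 p2 A B
    using indep_var_if_covariance_zero[OF that]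
      indep_var_imp_covariance_zero[OF _ finite_sign_vecs finite_sign_vecs,
        where A = A and B = B and f = "\<lambda>a. otimes_vec a $ i" and g = "\<lambda>b. otimes_vec b $ j" for i j]
    by blast
  show "\<exists>\<beta> \<in> carrier_vec (2 ^ p).
      AE w in M. real_cond_exp M (gen_algebra M p A) B w = \<beta> \<bullet> otimes_vec (A w)"
    if "A \<in> M \<rightarrow>\<^sub>M count_space (sign_vecs p)" for p A B
    using cond_exp_eq_scalar_prod_otimes[OF that, of B] by (meson AE_I2)
  fix p A \<beta> and B :: "'a \<Rightarrow> real"
  assume A: "A \<in> M \<rightarrow>\<^sub>M count_space (sign_vecs p)" and B: "B \<in> M \<rightarrow>\<^sub>M count_space {-1, 1}"
    and \<beta>: "\<beta> \<in> carrier_vec (2 ^ p)"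
    and eq: "AE w in M. real_cond_exp M (gen_algebra M p A) B w = \<beta> \<bullet> otimes_vec (A w)"
  have "integrable M B"
    using integrable_finite_valued[OF B, of "\<lambda>x. x"] by simp
  moreover have "AE w in M. \<bar>B w\<bar> \<le> 1"
    using measurable_space[OF B] by (intro AE_I2) force
  ultimately have bound: "\<bar>\<beta> \<bullet> otimes_vec a\<bar> \<le> 1" if "invertible_mat (gram M p A)" "a \<in> sign_vecs p" for a
    using cond_exp_coefficients_bounded[OF A that(1) _ _ eq that(2)] by blast
  have "gram M p A *\<^sub>v \<beta> = expect_vec M (2 ^ p) (\<lambda>w. B w \<cdot>\<^sub>v otimes_vec (A w))"
    by (rule gram_mult_cond_exp_coefficients[OF A B _ \<beta> eq]) simp
  then have "\<beta> = the (mat_inverse (gram M p A)) *\<^sub>v expect_vec M (2 ^ p) (\<lambda>w. B w \<cdot>\<^sub>v otimes_vec (A w))"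
    if "invertible_mat (gram M p A)"
    using the_mat_inverse_mult_vec[OF gram_carrier that \<beta>] by simp
  \<comment> \<open>The bound covers every sign vector, so it holds at each outcome and not only
    almost surely.\<close>
  moreover have "\<bar>\<beta> \<bullet> otimes_vec (A w)\<bar> \<le> 1" if "invertible_mat (gram M p A)" "w \<in> space M" for w
    using bound[OF that(1)] measurable_space[OF A that(2)] by simp
  ultimately show "let G = gram M p A in invertible_mat G \<longrightarrow>
      \<beta> = the (mat_inverse G) *\<^sub>v expect_vec M (2 ^ p) (\<lambda>w. B w \<cdot>\<^sub>v otimes_vec (A w)) \<and>
      (\<forall>w \<in> space M. \<bar>\<beta> \<bullet> otimes_vec (A w)\<bar> \<le> 1) \<and>
      linf_norm_vec (sylvester p *\<^sub>v \<beta>) \<le> 1 \<and> l2_norm_vec \<beta> \<le> 1"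
    using linf_norm_sylvester_le[OF \<beta> bound] l2_norm_le_if_otimes_bounded[OF \<beta> bound]
    unfolding Let_def by blast
qed

end
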